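(* (a) Bad trees are not reversible. (b) If $T$ is a tree having a node $N$ such that, for some $S\subset N$, the suborder $S\uparrow$ is a bad tree, then $T$ is not reversible.
   Context: A tree is a strict partial order $\langle T,<\rangle$ such that for each $t\in T$ the set $(\cdot,t):=\{s\in T:s<t\}$ is well-ordered or empty. The height of $t$ is the order type of $(\cdot,t)$; $L_\alpha$ is the set of elements of height $\alpha$; the height $\mathrm{ht}(T)$ of $T$ is the least ordinal $\alpha$ with $L_\alpha=\emptyset$. A branch is a maximal chain of $T$, and its height is its order type. The nodes of $T$ are the equivalence classes of the relation $s\sim t \Leftrightarrow (\cdot,s)=(\cdot,t)$. For $S\subset T$, $S\uparrow:=\{t\in T:\exists s\in S\; t\geq s\}$, regarded as a tree with the induced order. A tree is reversible iff every condensation of $T$, i.e. every bijection $f:T\to T$ such that $x<y$ implies $f(x)<f(y)$, is an automorphism of $T$. A tree $T$ is bad iff (b1) $\mathrm{ht}(T)=|T|=|L_0|$ is a regular cardinal (regular cardinals are infinite), and (b2) each branch of $T$ is of height $\mathrm{ht}(T)$. *)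

theory Defs
  imports Main
begin

unbundle cardinal_syntax

text \<open>
  An order is a carrier \<open>T\<close> with a strict relation \<open>r\<close>; only pairs of \<open>r\<close> inside \<open>T\<close> matter, so
  a subset of \<open>T\<close> paired with the same \<open>r\<close> is the suborder with the induced order. As in the
  library, an ordinal is a (reflexive) well-order relation up to isomorphism \<open>=o\<close>, the cardinal
  \<open>|A|\<close> being an initial ordinal. So \<open>Restr (r\<^sup>=) A\<close>, the reflexive form of \<open>r\<close> on \<open>A\<close>, represents
  the order type of \<open>A\<close>.
\<close>

definition preds :: "'a set \<Rightarrow> 'a rel \<Rightarrow> 'a \<Rightarrow> 'a set" where
  "preds T r t = {s \<in> T. (s, t) \<in> r}"

definition order_type :: "'a rel \<Rightarrow> 'a set \<Rightarrow> 'a rel" where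
  "order_type r A = Restr (r\<^sup>=) A"

definition tree :: "'a set \<Rightarrow> 'a rel \<Rightarrow> bool" where
  "tree T r \<longleftrightarrow> irrefl_on T r \<and> trans_on T r \<and>
     (\<forall>t\<in>T. well_order_on (preds T r t) (order_type r (preds T r t)))"

definition level :: "'a set \<Rightarrow> 'a rel \<Rightarrow> 'a rel \<Rightarrow> 'a set" where
  "level T r \<alpha> = {t \<in> T. order_type r (preds T r t) =o \<alpha>}"

text \<open>
  \<open>\<alpha>\<close> is the least ordinal whose level is empty. It suffices to consider well-orders on
  subsets of \<open>'a\<close>: all levels below the height are nonempty, so choosing an element from each
  of them represents the height by a well-order of a subset of \<open>T\<close>.
\<close>
definition has_height :: "'a set \<Rightarrow> 'a rel \<Rightarrow> 'a rel \<Rightarrow> bool" where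
  "has_height T r \<alpha> \<longleftrightarrow> Well_order \<alpha> \<and> level T r \<alpha> = {} \<and>
     (\<forall>\<beta>::'a rel. Well_order \<beta> \<and> level T r \<beta> = {} \<longrightarrow> \<alpha> \<le>o \<beta>)"

definition branch :: "'a set \<Rightarrow> 'a rel \<Rightarrow> 'a set \<Rightarrow> bool" where
  "branch T r B \<longleftrightarrow> pred_on.maxchain T (\<lambda>x y. (x, y) \<in> r) B"

definition nodes :: "'a set \<Rightarrow> 'a rel \<Rightarrow> 'a set set" where
  "nodes T r = T // {(s, t). s \<in> T \<and> t \<in> T \<and> preds T r s = preds T r t}"

definition up :: "'a set \<Rightarrow> 'a rel \<Rightarrow> 'a set \<Rightarrow> 'a set" where
  "up T r S = {t \<in> T. \<exists>s\<in>S. (s, t) \<in> r\<^sup>=}"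

definition condensation :: "'a set \<Rightarrow> 'a rel \<Rightarrow> ('a \<Rightarrow> 'a) \<Rightarrow> bool" where
  "condensation T r f \<longleftrightarrow> bij_betw f T T \<and> (\<forall>x\<in>T. \<forall>y\<in>T. (x, y) \<in> r \<longrightarrow> (f x, f y) \<in> r)"

definition automorphism :: "'a set \<Rightarrow> 'a rel \<Rightarrow> ('a \<Rightarrow> 'a) \<Rightarrow> bool" where
  "automorphism T r f \<longleftrightarrow> bij_betw f T T \<and> (\<forall>x\<in>T. \<forall>y\<in>T. (x, y) \<in> r \<longleftrightarrow> (f x, f y) \<in> r)"

definition reversible :: "'a set \<Rightarrow> 'a rel \<Rightarrow> bool" where
  "reversible T r \<longleftrightarrow> (\<forall>f. condensation T r f \<longrightarrow> automorphism T r f)"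

text \<open>
  The empty relation is the ordinal 0. The library's \<open>regularCard\<close> does not include infinity.
\<close>
definition bad_tree :: "'a set \<Rightarrow> 'a rel \<Rightarrow> bool" where
  "bad_tree T r \<longleftrightarrow> tree T r \<and>
     (\<exists>\<kappa>. has_height T r \<kappa> \<and> \<kappa> =o |T| \<and> |T| =o |level T r {}| \<and>
          Cinfinite \<kappa> \<and> regularCard \<kappa> \<and>
          (\<forall>B. branch T r B \<longrightarrow> order_type r B =o \<kappa>))"

end

theory Submission imports Defs begin

text \<open>
  A bad tree of cardinality \<open>\<kappa>\<close> has so much room upwards and so many roots that a condensation
  taking a root \<open>x\<^sub>0\<close> to a non-root \<open>y\<^sub>0\<close> can be built by a back-and-forth construction of
  length \<open>\<kappa>\<close>. Such a condensation is not an automorphism, since an automorphism carries the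
  (empty) set of predecessors of \<open>x\<^sub>0\<close> onto that of \<open>y\<^sub>0\<close>.

  The approximations are injective monotone partial maps of size \<open>< \<kappa>\<close> whose domain is closed
  under predecessors (\<open>partial_condensation\<close>). A new element \<open>x\<close> enters the domain together
  with all its predecessors (\<open>extend_to_domain\<close>): the part of the chain below \<open>x\<close> that is
  already mapped has as image a chain, which lies in a branch \<open>M\<close> of type \<open>\<kappa>\<close>. By
  regularity, a final segment of \<open>M\<close> lies above every value taken so far in \<open>M\<close>, and it
  still has size \<open>\<kappa>\<close>, so that the rest of the chain, which has size \<open>< \<kappa>\<close>, embeds in it. A
  new element \<open>y\<close> enters the range as the image of an unused root (\<open>extend_to_range\<close>): nothing
  lies below a root, and nothing above it is in the domain yet, so no constraint arises.
  Regularity keeps the approximations small at limits (\<open>regular_approximation\<close>).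

  For the second claim, extend a condensation of \<open>S\<up>\<close> by the identity. This is again
  monotone, because an element outside \<open>S\<up>\<close> which is below some element of \<open>S\<up>\<close> precedes an
  element of \<open>S\<close>, hence all of \<open>S\<close> since \<open>S\<close> is part of a node, hence all of \<open>S\<up>\<close>. So
  reversibility passes from the tree to \<open>S\<up>\<close> (\<open>reversible_up\<close>).
\<close>

section \<open>Transfinite approximation below a regular cardinal\<close>

text \<open>
  The bookkeeping of a construction in \<open>\<kappa>\<close> stages: the requirements \<open>Q x\<close>, one for each
  \<open>x \<in> X\<close>, are met one after the other along an initial well-ordering of \<open>X\<close>. Stage \<open>x\<close>
  extends the union of fewer than \<open>\<kappa>\<close> earlier stages, each of size \<open>< \<kappa>\<close>; as \<open>\<kappa>\<close> is
  regular, this union has size \<open>< \<kappa>\<close> as well, so that the extension hypothesis applies.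
\<close>

lemma regular_approximation:
  fixes \<kappa> :: "'k rel" and X :: "'x set" and P :: "'h set \<Rightarrow> bool"
  assumes reg: "Cinfinite \<kappa>" "regularCard \<kappa>" and X: "|X| \<le>o \<kappa>"
    and chain: "\<And>\<C>. \<C> \<noteq> {} \<Longrightarrow> subset.chain {A. P A} \<C> \<Longrightarrow> P (\<Union>\<C>)"
    and mono: "\<And>x A B. Q x A \<Longrightarrow> A \<subseteq> B \<Longrightarrow> Q x B"
    and ext: "\<And>x A. x \<in> X \<Longrightarrow> P A \<Longrightarrow> |A| <o \<kappa> \<Longrightarrow> \<exists>B. A \<subseteq> B \<and> P B \<and> |B| <o \<kappa> \<and> Q x B"
    and A0: "P A0" "|A0| <o \<kappa>"
  shows "\<exists>A. A0 \<subseteq> A \<and> P A \<and> (\<forall>x\<in>X. Q x A)"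
proof -
  let ?w = "|X|"
  have wo: "Well_order ?w" and F: "Field ?w = X"
    using card_of_Well_order[of X] by (simp_all add: Field_card_of)
  then have wo_rel: "wo_rel ?w" by (simp add: wo_rel_def)
  define stage where "stage f x = \<Union>(insert A0 (f ` underS ?w x))" for f :: "'x \<Rightarrow> 'h set" and x
  define good where "good f x A \<longleftrightarrow>
    (x \<in> X \<longrightarrow> stage f x \<subseteq> A \<and> P A \<and> |A| <o \<kappa> \<and> Q x A)" for f x A
  have below: "y \<in> X" if "y \<in> underS ?w x" for x y
    using that F by (auto simp: underS_def Field_def)
  have nested: "A \<subseteq> B \<or> B \<subseteq> A"
    if D: "D \<subseteq> X" "\<forall>y\<in>D. good f y (f y)" and A: "A \<in> insert A0 (f ` D)" and B: "B \<in> insert A0 (f ` D)"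
    for f D A B
  proof -
    have base: "A0 \<subseteq> f y" if "y \<in> D" for y
      using that D by (auto simp: good_def stage_def)
    have le: "f y \<subseteq> f z" if "y \<in> D" "z \<in> D" "(y, z) \<in> ?w" for y z
    proof (cases "y = z")
      case False
      then have "y \<in> underS ?w z" using that by (auto simp: underS_def)
      then show ?thesis using that D by (auto simp: good_def stage_def)
    qed simp
    have "f y \<subseteq> f z \<or> f z \<subseteq> f y" if "y \<in> D" "z \<in> D" for y z
      using le that wo_rel.TOTALS[OF wo_rel] D(1) F by blast
    then show ?thesis using A B base by blast
  qed
  have union: "P (\<Union>(insert A0 (f ` D)))" if D: "D \<subseteq> X" "\<forall>y\<in>D. good f y (f y)" for f D
  proof (rule chain)
    have "P A" if "A \<in> insert A0 (f ` D)" for A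
      using that D A0 by (auto simp: good_def)
    then show "subset.chain {A. P A} (insert A0 (f ` D))"
      unfolding subset_chain_def using nested[OF D] by blast
  qed simp
  have "\<exists>f. \<forall>x. good f x (f x)"
  proof (rule dependent_wf_choice[OF wo_rel.WF[OF wo_rel]])
    fix f g :: "'x \<Rightarrow> 'h set" and x A
    assume "\<And>z. (z, x) \<in> ?w - Id \<Longrightarrow> f z = g z"
    then have "f ` underS ?w x = g ` underS ?w x"
      by (intro image_cong) (auto simp: underS_def)
    then show "good f x A = good g x A" by (simp add: good_def stage_def)
  next
    fix x and f :: "'x \<Rightarrow> 'h set"
    assume IH: "\<And>y. (y, x) \<in> ?w - Id \<Longrightarrow> good f y (f y)"
    show "\<exists>A. good f x A"
    proof (cases "x \<in> X")
      case True
      let ?D = "underS ?w x"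
      have D: "?D \<subseteq> X" "\<forall>y\<in>?D. good f y (f y)"
        using below IH by (auto simp: underS_def)
      have "|?D| <o ?w" using card_of_underS[OF card_of_Card_order, of x X] True F by simp
      then have "|?D| <o \<kappa>" using X ordLess_ordLeq_trans by blast
      moreover have "\<forall>y\<in>?D. |f y| <o \<kappa>" using D by (auto simp: good_def)
      ultimately have "|\<Union>y\<in>?D. f y| <o \<kappa>"
        using card_of_UNION_ordLess_infinite_Field_regularCard reg by blast
      then have "|stage f x| <o \<kappa>"
        using card_of_Un_ordLess_infinite_Field[of \<kappa> A0 "\<Union>y\<in>?D. f y"] reg A0
        by (simp add: stage_def cinfinite_def)
      moreover have "P (stage f x)" using union[OF D] by (simp add: stage_def)
      ultimately show ?thesis using ext[OF True] by (auto simp: good_def)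
    qed (simp add: good_def)
  qed
  then obtain f where f: "\<forall>x. good f x (f x)" ..
  let ?A = "\<Union>(insert A0 (f ` X))"
  have "P ?A" using union[of X f] f by blast
  moreover have "Q x ?A" if "x \<in> X" for x
    by (rule mono[of x "f x"]) (use f that in \<open>auto simp: good_def\<close>)
  ultimately show ?thesis by (intro exI[of _ ?A]) auto
qed

section \<open>Chains and branches\<close>

lemma Field_order_type: "Field (order_type r A) = A"
  by (auto simp: order_type_def Field_def)

lemma order_type_Restr: "B \<subseteq> A \<Longrightarrow> Restr (order_type r A) B = order_type r B"
  by (auto simp: order_type_def)

lemma Well_order_order_type_mono:
  "Well_order (order_type r A) \<Longrightarrow> B \<subseteq> A \<Longrightarrow> Well_order (order_type r B)"
  using Well_order_Restr[of "order_type r A" B] by (simp add: order_type_Restr)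

lemma level_zero: "level T r {} = {t \<in> T. preds T r t = {}}"
proof -
  have "order_type r A =o ({}::'a rel) \<longleftrightarrow> A = {}" for A
  proof
    assume "order_type r A =o ({}::'a rel)"
    then have "|Field (order_type r A)| \<le>o |Field ({}::'a rel)|"
      by (intro card_of_mono2 ordIso_imp_ordLeq)
    then show "A = {}" using card_of_empty3[of A] by (simp add: Field_order_type)
  next
    assume "A = {}"
    moreover have "({}::'a rel) =o ({}::'a rel)" by (rule ordIso_reflexive) simp
    ultimately show "order_type r A =o ({}::'a rel)" by (simp add: order_type_def)
  qed
  then show ?thesis by (auto simp: level_def)
qed

lemma pred_chain_iff:
  "pred_on.chain T (\<lambda>x y. (x, y) \<in> r) C \<longleftrightarrow>
    C \<subseteq> T \<and> (\<forall>x\<in>C. \<forall>y\<in>C. x = y \<or> (x, y) \<in> r \<or> (y, x) \<in> r)"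
  by (auto simp: pred_on.chain_def)

text \<open>
  Hausdorff's principle is applied to the set of the elements comparable with all of \<open>C\<close>:
  every maximal chain there absorbs \<open>C\<close>.
\<close>

lemma chain_extends_to_branch:
  assumes C: "pred_on.chain T (\<lambda>x y. (x, y) \<in> r) C"
  obtains B where "branch T r B" "C \<subseteq> B"
proof -
  define U where "U = {t \<in> T. \<forall>c\<in>C. t = c \<or> (t, c) \<in> r \<or> (c, t) \<in> r}"
  obtain M where M: "pred_on.maxchain U (\<lambda>x y. (x, y) \<in> r) M"
    using pred_on.Hausdorff by blast
  then have chM: "pred_on.chain U (\<lambda>x y. (x, y) \<in> r) M"
    and maxM: "\<And>S. pred_on.chain U (\<lambda>x y. (x, y) \<in> r) S \<Longrightarrow> M \<subseteq> S \<Longrightarrow> S = M"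
    by (auto simp: pred_on.maxchain_def)
  have MU: "M \<subseteq> U" and CU: "C \<subseteq> U" using chM C by (auto simp: pred_chain_iff U_def)
  have "pred_on.chain U (\<lambda>x y. (x, y) \<in> r) (M \<union> C)"
    using chM C MU CU unfolding pred_chain_iff by (auto simp: U_def)
  then have CM: "C \<subseteq> M" using maxM by blast
  have "\<not> M \<subset> S" if S: "pred_on.chain T (\<lambda>x y. (x, y) \<in> r) S" for S
  proof
    assume "M \<subset> S"
    then have "S \<subseteq> U" using S CM unfolding pred_chain_iff U_def by blast
    then have "pred_on.chain U (\<lambda>x y. (x, y) \<in> r) S" using S by (auto simp: pred_chain_iff)
    then show False using maxM \<open>M \<subset> S\<close> by blast
  qed
  moreover have "pred_on.chain T (\<lambda>x y. (x, y) \<in> r) M"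
    using chM by (auto simp: pred_chain_iff U_def)
  ultimately have "branch T r M"
    by (auto simp: branch_def pred_on.maxchain_def)
  then show thesis using CM that by blast
qed

lemma tree_preds_comparable:
  assumes "tree T r" "t \<in> T" "x \<in> preds T r t" "y \<in> preds T r t"
  shows "x = y \<or> (x, y) \<in> r \<or> (y, x) \<in> r"
proof -
  have "total_on (preds T r t) (order_type r (preds T r t))"
    using assms by (auto simp: tree_def well_order_on_def linear_order_on_def)
  then show ?thesis using assms(3,4) by (auto simp: total_on_def order_type_def)
qed

lemma tree_chain_upto:
  assumes "tree T r" "t \<in> T"
  shows "pred_on.chain T (\<lambda>x y. (x, y) \<in> r) (insert t (preds T r t))"
  using tree_preds_comparable[OF assms] assms(2) by (auto simp: pred_chain_iff preds_def)

lemma small_Well_order_embeds: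
  assumes "Well_order p" "Well_order q" "|Field p| <o |Field q|"
  obtains e where "embed p q e"
proof -
  have "\<not> q \<le>o p"
    using assms(3) card_of_mono2[of q p] not_ordLess_ordLeq by blast
  then have "p \<le>o q" using assms ordLeq_total by blast
  then show thesis using that by (auto simp: ordLeq_def)
qed

section \<open>Partial condensations\<close>

text \<open>
  Such maps are represented by their graphs, so that extension is inclusion and the limit of
  an increasing family is its union. The domain has to be closed under predecessors: otherwise an
  element added later below an element of the domain might find no room below its image.
\<close>

definition partial_condensation :: "'a set \<Rightarrow> 'a rel \<Rightarrow> 'a rel \<Rightarrow> bool" where
  "partial_condensation T r H \<longleftrightarrow> H \<subseteq> T \<times> T \<and> single_valued H \<and> single_valued (H\<inverse>) \<and>
     (\<forall>y\<in>Domain H. preds T r y \<subseteq> Domain H) \<and>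
     (\<forall>x u y v. (x, u) \<in> H \<and> (y, v) \<in> H \<and> (x, y) \<in> r \<longrightarrow> (u, v) \<in> r)"

lemma partial_condensation_Union:
  assumes "subset.chain {H. partial_condensation T r H} \<H>"
  shows "partial_condensation T r (\<Union>\<H>)"
proof -
  have all: "partial_condensation T r H" if "H \<in> \<H>" for H
    using that assms by (auto simp: subset_chain_def)
  have both: "\<exists>H\<in>\<H>. p \<in> H \<and> q \<in> H" if "p \<in> \<Union>\<H>" "q \<in> \<Union>\<H>" for p q
    using that assms unfolding subset_chain_def by blast
  have "\<Union>\<H> \<subseteq> T \<times> T" using all unfolding partial_condensation_def by blast
  moreover have "single_valued (\<Union>\<H>)"
  proof (rule single_valuedI)
    fix x y z assume "(x, y) \<in> \<Union>\<H>" "(x, z) \<in> \<Union>\<H>"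
    with both[of "(x, y)" "(x, z)"] all show "y = z"
      unfolding partial_condensation_def single_valued_def by blast
  qed
  moreover have "single_valued ((\<Union>\<H>)\<inverse>)"
  proof (rule single_valuedI)
    fix x y z assume "(x, y) \<in> (\<Union>\<H>)\<inverse>" "(x, z) \<in> (\<Union>\<H>)\<inverse>"
    with both[of "(y, x)" "(z, x)"] all show "y = z"
      unfolding partial_condensation_def single_valued_def by blast
  qed
  moreover have "preds T r y \<subseteq> Domain (\<Union>\<H>)" if "y \<in> Domain (\<Union>\<H>)" for y
    using that all unfolding partial_condensation_def by blast
  moreover have "(u, v) \<in> r" if "(x, u) \<in> \<Union>\<H>" "(y, v) \<in> \<Union>\<H>" "(x, y) \<in> r" for x u y v
    using both[OF that(1,2)] all that(3) unfolding partial_condensation_def by blast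
  ultimately show ?thesis unfolding partial_condensation_def by blast
qed

lemma total_partial_condensation:
  assumes H: "partial_condensation T r H" and "T \<subseteq> Domain H" "T \<subseteq> Range H"
  obtains f where "condensation T r f" "\<forall>(x, y)\<in>H. f x = y"
proof
  define f where "f x = (THE y. (x, y) \<in> H)" for x
  have f: "f x = y" if "(x, y) \<in> H" for x y
    unfolding f_def using that H by (auto simp: partial_condensation_def single_valued_def)
  then show "\<forall>(x, y)\<in>H. f x = y" by blast
  have fH: "(x, f x) \<in> H" if "x \<in> T" for x
    using that assms(2) f by fastforce
  have "inj_on f T"
  proof (rule inj_onI)
    fix x y assume "x \<in> T" "y \<in> T" "f x = f y"
    then have "(f x, x) \<in> H\<inverse>" "(f x, y) \<in> H\<inverse>" using fH[of x] fH[of y] by auto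
    then show "x = y" using H unfolding partial_condensation_def single_valued_def by blast
  qed
  moreover have "f ` T = T"
  proof
    show "f ` T \<subseteq> T" using fH H unfolding partial_condensation_def by blast
    show "T \<subseteq> f ` T"
    proof
      fix y assume "y \<in> T"
      then obtain x where x: "(x, y) \<in> H" using assms(3) by blast
      then have "x \<in> T" using H unfolding partial_condensation_def by blast
      then show "y \<in> f ` T" using f[OF x] by blast
    qed
  qed
  moreover have "(f x, f y) \<in> r" if "x \<in> T" "y \<in> T" "(x, y) \<in> r" for x y
    using fH[OF that(1)] fH[OF that(2)] that(3) H unfolding partial_condensation_def by blast
  ultimately show "condensation T r f" by (auto simp: condensation_def bij_betw_def)
qed

section \<open>The back-and-forth construction\<close>

locale bad_tree_of_size =
  fixes T :: "'a set" and r :: "'a rel" and \<kappa> :: "'a rel"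
  assumes tree: "tree T r"
    and inf: "Cinfinite \<kappa>" and reg: "regularCard \<kappa>"
    and card_T: "|T| =o \<kappa>"
    and card_roots: "|{t \<in> T. preds T r t = {}}| =o \<kappa>"
    and branches: "branch T r M \<Longrightarrow> order_type r M =o \<kappa>"
begin

lemma small_Un: "|A| <o \<kappa> \<Longrightarrow> |B| <o \<kappa> \<Longrightarrow> |A \<union> B| <o \<kappa>"
  using card_of_Un_ordLess_infinite_Field inf by (auto simp: cinfinite_def)

lemma small_singleton: "|{a}| <o \<kappa>"
  using Cfinite_ordLess_Cinfinite[OF _ inf, of "|{a}|"] card_of_Card_order[of "{a}"]
  by (auto simp: cfinite_def Field_card_of)

lemma small_subset: "A \<subseteq> B \<Longrightarrow> |B| <o \<kappa> \<Longrightarrow> |A| <o \<kappa>"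
  using card_of_mono1 ordLeq_ordLess_trans by blast

lemma small_image: "|A| <o \<kappa> \<Longrightarrow> |f ` A| <o \<kappa>"
  using card_of_image ordLeq_ordLess_trans by blast

lemma branch_Cinfinite: "branch T r M \<Longrightarrow> Cinfinite (order_type r M)"
  using branches inf Cinfinite_cong ordIso_symmetric by blast

lemma branch_Well_order: "branch T r M \<Longrightarrow> Well_order (order_type r M)"
  using branches by (auto simp: ordIso_def)

lemma branch_subset: "branch T r M \<Longrightarrow> M \<subseteq> T"
  by (auto simp: branch_def pred_on.maxchain_def pred_chain_iff)

lemma irrefl: "x \<in> T \<Longrightarrow> (x, x) \<notin> r"
  using tree by (auto simp: tree_def irrefl_on_def)

lemma trans: "x \<in> T \<Longrightarrow> y \<in> T \<Longrightarrow> z \<in> T \<Longrightarrow> (x, y) \<in> r \<Longrightarrow> (y, z) \<in> r \<Longrightarrow> (x, z) \<in> r"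
  using tree unfolding tree_def by (meson trans_onD)

lemma branch_linear: "branch T r M \<Longrightarrow> x \<in> M \<Longrightarrow> y \<in> M \<Longrightarrow> x = y \<or> (x, y) \<in> r \<or> (y, x) \<in> r"
  by (auto simp: branch_def pred_on.maxchain_def pred_chain_iff)

text \<open>
  This is where regularity meets the height of the branches: a small part of a branch is not
  cofinal in it. The bound is made strict by passing to a later element, as an infinite cardinal
  is a limit ordinal; being strict, it also lies outside \<open>K\<close>.
\<close>

lemma small_bounded_in_branch:
  assumes M: "branch T r M" and K: "|K| <o \<kappa>"
  obtains a where "a \<in> M" "\<And>b. b \<in> K \<Longrightarrow> b \<in> M \<Longrightarrow> (b, a) \<in> r"
proof -
  let ?W = "order_type r M"
  have F: "Field ?W = M" by (rule Field_order_type)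
  have W: "?W =o \<kappa>" "Cinfinite ?W" using M branches branch_Cinfinite by auto
  have "regularCard ?W" using regularCard_ordIso inf reg W ordIso_symmetric by blast
  moreover have "|K \<inter> M| <o ?W"
    using small_subset[of "K \<inter> M" K] K W ordLess_ordIso_trans ordIso_symmetric by blast
  ultimately have "\<not> cofinal (K \<inter> M) ?W"
    unfolding regularCard_def F using not_ordLess_ordIso by (metis inf_le2)
  then obtain c where c: "c \<in> M" "\<forall>b\<in>K \<inter> M. c = b \<or> (c, b) \<notin> ?W"
    by (auto simp: cofinal_def F)
  obtain a where a: "a \<in> M" "c \<noteq> a" "(c, a) \<in> ?W"
    using infinite_Card_order_limit[of ?W c] W c F by (auto simp: cinfinite_def)
  have ca: "(c, a) \<in> r" using a by (auto simp: order_type_def)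
  have "(b, a) \<in> r" if b: "b \<in> K" "b \<in> M" for b
  proof (cases "b = c")
    case False
    then have "(c, b) \<notin> r" using c b by (auto simp: order_type_def)
    then have "(b, c) \<in> r" using branch_linear[OF M] b c(1) False by blast
    then show ?thesis using trans[OF _ _ _ _ ca] branch_subset[OF M] a(1) b(2) c(1) by blast
  qed (use ca in simp)
  then show thesis using that a(1) by blast
qed

text \<open>
  The predecessors of \<open>t\<close> form part of a proper initial segment of a branch, which is smaller
  than \<open>\<kappa>\<close> because the branch is ordered like the initial ordinal \<open>\<kappa>\<close>.
\<close>

lemma small_preds:
  assumes t: "t \<in> T"
  shows "|insert t (preds T r t)| <o \<kappa>"
proof -
  obtain M where M: "branch T r M" "insert t (preds T r t) \<subseteq> M"
    using chain_extends_to_branch[OF tree_chain_upto[OF tree t]] .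
  let ?W = "order_type r M"
  have "|underS ?W t| <o ?W"
    using card_of_underS[of ?W t] branch_Cinfinite[OF M(1)] M(2) by (simp add: Field_order_type)
  then have "|underS ?W t| <o \<kappa>" using branches[OF M(1)] ordLess_ordIso_trans by blast
  moreover have "preds T r t \<subseteq> underS ?W t"
    using M(2) irrefl t by (auto simp: underS_def order_type_def preds_def)
  ultimately have "|preds T r t| <o \<kappa>" using small_subset by blast
  then show ?thesis using small_Un[OF small_singleton[of t]] by simp
qed

text \<open>
  A small final segment would be bounded by an element of its own.
\<close>

lemma card_tail:
  assumes M: "branch T r M" and a: "a \<in> M"
  shows "\<not> |{b \<in> M. (a, b) \<in> r}| <o \<kappa>"
proof
  let ?U = "{b \<in> M. (a, b) \<in> r}"
  assume "|?U| <o \<kappa>"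
  then have "|insert a ?U| <o \<kappa>" using small_Un[OF small_singleton[of a]] by simp
  then obtain c where c: "c \<in> M" "\<And>b. b \<in> insert a ?U \<Longrightarrow> b \<in> M \<Longrightarrow> (b, c) \<in> r"
    using small_bounded_in_branch[OF M] by blast
  then have "c \<in> ?U" using a by blast
  then show False using c irrefl branch_subset[OF M] by blast
qed

text \<open>
  With \<open>L\<close> the set of the elements up to \<open>x\<close>, the missing part \<open>E\<close> of \<open>L\<close> is embedded by
  \<open>e\<close> into the final segment \<open>U\<close> of a branch through the image of \<open>L\<close>. As \<open>U\<close> starts
  beyond all the values that \<open>H\<close> takes in this branch, the new values are above the images
  of the predecessors and differ from all the old values.
\<close>

lemma extend_to_domain:
  assumes H: "partial_condensation T r H" and small: "|H| <o \<kappa>" and x: "x \<in> T"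
  shows "\<exists>H'. H \<subseteq> H' \<and> partial_condensation T r H' \<and> |H'| <o \<kappa> \<and> x \<in> Domain H'"
proof -
  have HT: "H \<subseteq> T \<times> T" and H1: "single_valued H" and H2: "single_valued (H\<inverse>)"
    and down: "\<And>y z. y \<in> Domain H \<Longrightarrow> z \<in> preds T r y \<Longrightarrow> z \<in> Domain H"
    and Hmono: "\<And>x u y v. (x, u) \<in> H \<Longrightarrow> (y, v) \<in> H \<Longrightarrow> (x, y) \<in> r \<Longrightarrow> (u, v) \<in> r"
    using H unfolding partial_condensation_def by blast+
  let ?L = "insert x (preds T r x)"
  define E where "E = ?L - Domain H"
  have chL: "pred_on.chain T (\<lambda>x y. (x, y) \<in> r) ?L" by (rule tree_chain_upto[OF tree x])
  have "pred_on.chain T (\<lambda>x y. (x, y) \<in> r) (H `` ?L)"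
    unfolding pred_chain_iff
  proof (intro conjI ballI)
    show "H `` ?L \<subseteq> T" using HT by blast
    fix u v assume "u \<in> H `` ?L" "v \<in> H `` ?L"
    then obtain y z where yz: "y \<in> ?L" "z \<in> ?L" "(y, u) \<in> H" "(z, v) \<in> H" by blast
    then have "y = z \<or> (y, z) \<in> r \<or> (z, y) \<in> r" using chL unfolding pred_chain_iff by blast
    then show "u = v \<or> (u, v) \<in> r \<or> (v, u) \<in> r"
      using yz Hmono single_valuedD[OF H1] by metis
  qed
  then obtain M where M: "branch T r M" "H `` ?L \<subseteq> M" by (rule chain_extends_to_branch)
  have "|snd ` H| <o \<kappa>" by (rule small_image[OF small])
  then obtain a where a: "a \<in> M" "\<And>b. b \<in> Range H \<Longrightarrow> b \<in> M \<Longrightarrow> (b, a) \<in> r"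
    using small_bounded_in_branch[OF M(1)] by (metis Range_snd)
  define U where "U = {b \<in> M. (a, b) \<in> r}"
  (* A branch through L serves to well-order E, as x itself is not among its predecessors. *)
  obtain N where N: "branch T r N" "?L \<subseteq> N" using chain_extends_to_branch[OF chL] .
  have WE: "Well_order (order_type r E)"
    by (rule Well_order_order_type_mono[OF branch_Well_order[OF N(1)]]) (use N(2) in \<open>auto simp: E_def\<close>)
  have WU: "Well_order (order_type r U)"
    by (rule Well_order_order_type_mono[OF branch_Well_order[OF M(1)]]) (auto simp: U_def)
  have smallE: "|E| <o \<kappa>" using small_subset[OF _ small_preds[OF x]] by (auto simp: E_def)
  have "|E| <o |U|"
  proof -
    have "\<not> |U| <o \<kappa>" using card_tail[OF M(1) a(1)] by (simp add: U_def)
    then have "\<kappa> \<le>o |U|" using inf not_ordLess_iff_ordLeq card_of_Well_order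
      by (meson card_order_on_well_order_on)
    then show ?thesis using smallE ordLess_ordLeq_trans by blast
  qed
  then obtain e where e: "embed (order_type r E) (order_type r U) e"
    using small_Well_order_embeds[OF WE WU] by (auto simp: Field_order_type)
  have e_inj: "inj_on e E" using embed_inj_on[OF WE e] by (simp add: Field_order_type)
  have eU: "e ` E \<subseteq> U" using embed_Field[OF e] by (simp add: Field_order_type)
  have e_mono: "(e y, e z) \<in> r" if "y \<in> E" "z \<in> E" "(y, z) \<in> r" for y z
  proof -
    have "(e y, e z) \<in> order_type r U"
      using embed_compat[OF e] that unfolding compat_def order_type_def by blast
    moreover have "y \<noteq> z" using that irrefl x unfolding E_def preds_def by blast
    ultimately show ?thesis using inj_onD[OF e_inj, of y z] that by (auto simp: order_type_def)
  qed
  have ET: "E \<subseteq> T" using x by (auto simp: E_def preds_def)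
  have MT: "M \<subseteq> T" using branch_subset[OF M(1)] .
  have UT: "U \<subseteq> T" using MT by (auto simp: U_def)
  have fresh: "u \<notin> Range H" if "u \<in> U" for u
  proof
    assume "u \<in> Range H"
    then have "(u, a) \<in> r" "(a, u) \<in> r" using that a by (auto simp: U_def)
    then show False using trans irrefl that a(1) MT UT by blast
  qed
  define H' where "H' = H \<union> (\<lambda>y. (y, e y)) ` E"
  have dom: "Domain H' = Domain H \<union> E" by (auto simp: H'_def)
  have "|H'| <o \<kappa>" unfolding H'_def by (intro small_Un small small_image smallE)
  moreover have "partial_condensation T r H'"
    unfolding partial_condensation_def
  proof (intro conjI allI impI ballI)
    show "H' \<subseteq> T \<times> T" using HT ET eU UT by (auto simp: H'_def)
    show "single_valued H'"
      using single_valuedD[OF H1] by (auto simp: single_valued_def H'_def E_def)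
    show "single_valued (H'\<inverse>)"
    proof (rule single_valuedI)
      fix u y z assume "(u, y) \<in> H'\<inverse>" "(u, z) \<in> H'\<inverse>"
      then consider "(y, u) \<in> H" "(z, u) \<in> H" | "y \<in> E" "z \<in> E" "e y = e z"
        | "u \<in> Range H" "u \<in> e ` E"
        by (auto simp: H'_def)
      then show "y = z"
      proof cases
        case 1 then show ?thesis using single_valuedD[OF H2] by auto
      next
        case 2 then show ?thesis using inj_onD[OF e_inj] by blast
      next
        case 3 then show ?thesis using fresh eU by blast
      qed
    qed
    show "preds T r y \<subseteq> Domain H'" if "y \<in> Domain H'" for y
    proof
      fix z assume z: "z \<in> preds T r y"
      show "z \<in> Domain H'"
      proof (cases "y \<in> Domain H")
        case True then show ?thesis using down z dom by blast
      next
        case False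
        then have "y \<in> ?L" using that dom by (auto simp: E_def)
        then have "z \<in> ?L" using z x trans by (auto simp: preds_def)
        then show ?thesis using dom by (auto simp: E_def)
      qed
    qed
    fix y u z v assume *: "(y, u) \<in> H' \<and> (z, v) \<in> H' \<and> (y, z) \<in> r"
    then consider "(y, u) \<in> H" "(z, v) \<in> H" | "(y, u) \<in> H" "z \<in> E" "v = e z"
      | "y \<in> E" "(z, v) \<in> H" | "y \<in> E" "u = e y" "z \<in> E" "v = e z"
      by (auto simp: H'_def)
    then show "(u, v) \<in> r"
    proof cases
      case 1 then show ?thesis using Hmono * by blast
    next
      case 2
      then have "y \<in> ?L" using * x HT trans by (auto simp: E_def preds_def)
      then have "u \<in> M" using 2 M(2) by blast
      then have "(u, a) \<in> r" using a 2 by blast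
      moreover have "v \<in> U" using 2 eU by blast
      ultimately show ?thesis using trans[of u a v] MT a(1) \<open>u \<in> M\<close> by (auto simp: U_def)
    next
      case 3
      then have "y \<in> preds T r z" using * ET by (auto simp: preds_def)
      then have "y \<in> Domain H" using down 3 by blast
      then show ?thesis using 3 by (simp add: E_def)
    next
      case 4 then show ?thesis using e_mono * by blast
    qed
  qed
  moreover have "x \<in> Domain H'" using dom by (auto simp: E_def)
  moreover have "H \<subseteq> H'" by (auto simp: H'_def)
  ultimately show ?thesis by blast
qed

lemma unused_root:
  assumes "|H| <o \<kappa>"
  obtains x where "x \<in> T" "preds T r x = {}" "x \<notin> Domain H"
proof -
  let ?R = "{t \<in> T. preds T r t = {}}"
  have "|Domain H| <o \<kappa>" using small_image[OF assms, of fst] by (simp add: Domain_fst)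
  moreover have "\<not> |?R| <o \<kappa>" using card_roots not_ordLess_ordIso by blast
  ultimately have "\<not> ?R \<subseteq> Domain H" using small_subset by blast
  then show thesis using that by blast
qed

text \<open>
  The unused root \<open>x\<close> can be sent anywhere: nothing is below it, and no element above it is
  in the domain of \<open>H\<close>, which would contain \<open>x\<close> too.
\<close>

lemma extend_to_range:
  assumes H: "partial_condensation T r H" and small: "|H| <o \<kappa>" and y: "y \<in> T"
  shows "\<exists>H'. H \<subseteq> H' \<and> partial_condensation T r H' \<and> |H'| <o \<kappa> \<and> y \<in> Range H'"
proof (cases "y \<in> Range H")
  case False
  obtain x where x: "x \<in> T" "preds T r x = {}" "x \<notin> Domain H" using unused_root[OF small] .
  have no: "(z, x) \<notin> r" if "z \<in> T" for z using that x(2) by (auto simp: preds_def)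
  have up: "(x, z) \<notin> r" if "z \<in> Domain H" for z
    using that x H unfolding partial_condensation_def preds_def by blast
  have "|insert (x, y) H| <o \<kappa>" using small_Un[OF small_singleton small] by simp
  moreover have "partial_condensation T r (insert (x, y) H)"
    using H False x y no up
    unfolding partial_condensation_def single_valued_def by auto blast+
  ultimately show ?thesis by (intro exI[of _ "insert (x, y) H"]) auto
qed (use H small in blast)

lemma nonroot_exists:
  obtains y where "y \<in> T" "preds T r y \<noteq> {}"
proof -
  have "pred_on.chain T (\<lambda>x y. (x, y) \<in> r) {}" by (simp add: pred_chain_iff)
  then obtain M where M: "branch T r M" by (rule chain_extends_to_branch)
  have "|{}::'a set| <o \<kappa>" using small_subset[OF empty_subsetI small_singleton] .
  then obtain a where a: "a \<in> M" using small_bounded_in_branch[OF M] by blast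
  obtain b where "b \<in> M" "(a, b) \<in> r"
    using small_bounded_in_branch[OF M small_singleton[of a]] a by blast
  then show thesis using that a branch_subset[OF M] by (auto simp: preds_def)
qed

text \<open>
  The construction starts from the single pair of a root and a non-root.
\<close>

lemma not_reversible: "\<not> reversible T r"
proof -
  have "|{}::('a \<times> 'a) set| <o \<kappa>" using small_subset[OF empty_subsetI small_singleton] .
  then obtain x0 where x0: "x0 \<in> T" "preds T r x0 = {}" using unused_root by blast
  obtain y0 where y0: "y0 \<in> T" "preds T r y0 \<noteq> {}" using nonroot_exists .
  have start: "partial_condensation T r {(x0, y0)}"
    using x0 y0 irrefl by (auto simp: partial_condensation_def single_valued_def)
  have start_small: "|{(x0, y0)}| <o \<kappa>" using small_image[OF small_singleton[of x0], of "\<lambda>x. (x, y0)"] by simp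
  have "\<exists>H. {(x0, y0)} \<subseteq> H \<and> partial_condensation T r H \<and> (\<forall>t\<in>T. t \<in> Domain H \<and> t \<in> Range H)"
  proof (rule regular_approximation[where P = "partial_condensation T r"
        and Q = "\<lambda>t H. t \<in> Domain H \<and> t \<in> Range H",
        OF inf reg _ _ _ _ start start_small])
    show "|T| \<le>o \<kappa>" using card_T by (rule ordIso_imp_ordLeq)
    show "partial_condensation T r (\<Union>\<H>)" if "subset.chain {H. partial_condensation T r H} \<H>" for \<H>
      using that by (rule partial_condensation_Union)
    fix t H assume t: "t \<in> T" and H: "partial_condensation T r H" "|H| <o \<kappa>"
    obtain H1 where H1: "H \<subseteq> H1" "partial_condensation T r H1" "|H1| <o \<kappa>" "t \<in> Domain H1"
      using extend_to_domain[OF H t] by blast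
    obtain H2 where H2: "H1 \<subseteq> H2" "partial_condensation T r H2" "|H2| <o \<kappa>" "t \<in> Range H2"
      using extend_to_range[OF H1(2,3) t] by blast
    have "H \<subseteq> H2" "t \<in> Domain H2" using H1(1,4) H2(1) by auto
    then show "\<exists>H'. H \<subseteq> H' \<and> partial_condensation T r H' \<and> |H'| <o \<kappa> \<and> t \<in> Domain H' \<and> t \<in> Range H'"
      using H2 by blast
  next
    fix t and A B :: "'a rel"
    assume "t \<in> Domain A \<and> t \<in> Range A" "A \<subseteq> B"
    then show "t \<in> Domain B \<and> t \<in> Range B" by blast
  qed
  then obtain H where "{(x0, y0)} \<subseteq> H \<and> partial_condensation T r H \<and>
      (\<forall>t\<in>T. t \<in> Domain H \<and> t \<in> Range H)" by (elim exE)
  then have H: "(x0, y0) \<in> H" "partial_condensation T r H" "T \<subseteq> Domain H" "T \<subseteq> Range H"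
    by auto
  obtain f where f: "condensation T r f" "\<forall>(x, y)\<in>H. f x = y"
    using total_partial_condensation[OF H(2-4)] .
  have fx0: "f x0 = y0" using f(2) H(1) by auto
  have "\<not> automorphism T r f"
  proof
    assume auto: "automorphism T r f"
    obtain z where z: "z \<in> T" "(z, y0) \<in> r" using y0(2) by (auto simp: preds_def)
    have "z \<in> f ` T" using auto z(1) by (simp add: automorphism_def bij_betw_def)
    then obtain w where w: "w \<in> T" "z = f w" by (elim imageE)
    have "(w, x0) \<in> r \<longleftrightarrow> (f w, f x0) \<in> r"
      using auto w(1) x0(1) by (simp add: automorphism_def)
    then have "(w, x0) \<in> r" using z(2) w(2) fx0 by simp
    then show False using x0(2) w(1) by (auto simp: preds_def)
  qed
  then show ?thesis using f(1) by (auto simp: reversible_def)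
qed

end

lemma bad_tree_not_reversible:
  assumes "bad_tree T r"
  shows "\<not> reversible T r"
proof -
  obtain \<kappa> where "has_height T r \<kappa> \<and> \<kappa> =o |T| \<and> |T| =o |level T r {}| \<and>
      Cinfinite \<kappa> \<and> regularCard \<kappa> \<and> (\<forall>B. branch T r B \<longrightarrow> order_type r B =o \<kappa>)"
    using conjunct2[OF assms[unfolded bad_tree_def]] ..
  then have k: "\<kappa> =o |T|" "|T| =o |level T r {}|" "Cinfinite \<kappa>" "regularCard \<kappa>"
    "\<And>B. branch T r B \<Longrightarrow> order_type r B =o \<kappa>" by simp_all
  have "|T| =o \<kappa>" using ordIso_symmetric[OF k(1)] .
  moreover have "|{t \<in> T. preds T r t = {}}| =o \<kappa>"
    using ordIso_symmetric[OF ordIso_transitive[OF k(1,2)]] unfolding level_zero .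
  moreover have "tree T r" using assms by (simp add: bad_tree_def)
  ultimately interpret bad_tree_of_size T r \<kappa> using k by unfold_locales auto
  show ?thesis by (rule not_reversible)
qed

section \<open>Extending condensations by the identity\<close>

text \<open>
  A condensation \<open>f\<close> of the upper part is extended to \<open>T\<close> by the identity. The only pairs
  on which monotonicity is not immediate are those leading from outside into the upper part;
  \<open>below\<close> shows that the lower element of such a pair precedes the whole upper part.
\<close>

lemma reversible_up:
  assumes tree: "tree T r" and N: "N \<in> nodes T r" and S: "S \<subseteq> N" and rev: "reversible T r"
  shows "reversible (up T r S) r"
  unfolding reversible_def
proof (intro allI impI)
  let ?U = "up T r S"
  fix f assume f: "condensation ?U r f"
  have trans: "(x, z) \<in> r" if "x \<in> T" "y \<in> T" "z \<in> T" "(x, y) \<in> r" "(y, z) \<in> r" for x y z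
    using tree that unfolding tree_def by (meson trans_onD)
  have ST: "S \<subseteq> T" and same: "\<And>s s'. s \<in> S \<Longrightarrow> s' \<in> S \<Longrightarrow> preds T r s = preds T r s'"
    using N S unfolding nodes_def quotient_def by auto
  have UT: "?U \<subseteq> T" by (auto simp: up_def)
  have above: "y \<in> ?U" if "x \<in> ?U" "y \<in> T" "(x, y) \<in> r" for x y
    using that trans[OF _ _ that(2) _ that(3)] ST unfolding up_def by blast
  have below: "(x, z) \<in> r" if x: "x \<in> T - ?U" "y \<in> ?U" "(x, y) \<in> r" and z: "z \<in> ?U" for x y z
  proof -
    obtain s where s: "s \<in> S" "s = y \<or> (s, y) \<in> r" using x(2) by (auto simp: up_def)
    (* x and s are comparable, being below y, and s <= x would put x into the upper part. *)
    have "(x, s) \<in> r"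
    proof (cases "s = y")
      case False
      then have "x = s \<or> (x, s) \<in> r \<or> (s, x) \<in> r"
        using tree_preds_comparable[OF tree, of y x s] s x UT ST by (auto simp: preds_def)
      then show ?thesis using x(1) s(1) by (auto simp: up_def)
    qed (use x in simp)
    then have xs: "(x, s') \<in> r" if "s' \<in> S" for s'
      using same[OF s(1) that] x(1) unfolding preds_def by blast
    obtain s' where s': "s' \<in> S" "s' = z \<or> (s', z) \<in> r" using z by (auto simp: up_def)
    then show ?thesis using xs trans[of x s' z] x(1) z UT ST by blast
  qed
  define g where "g x = (if x \<in> ?U then f x else x)" for x
  have fU: "bij_betw f ?U ?U" using f by (simp add: condensation_def)
  have gU: "g x \<in> ?U \<longleftrightarrow> x \<in> ?U" for x
    using fU by (auto simp: g_def bij_betw_def)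
  have "bij_betw g (?U \<union> (T - ?U)) (?U \<union> (T - ?U))"
  proof (rule bij_betw_combine)
    show "bij_betw g ?U ?U" using fU by (simp add: g_def cong: bij_betw_cong)
    show "bij_betw g (T - ?U) (T - ?U)"
      using bij_betw_id[of "T - ?U"] by (auto simp: g_def bij_betw_def inj_on_def image_iff)
  qed auto
  then have "bij_betw g T T" using UT by (simp add: Un_absorb1)
  moreover have "(g x, g y) \<in> r" if "x \<in> T" "y \<in> T" "(x, y) \<in> r" for x y
  proof (cases "x \<in> ?U")
    case True
    then have "y \<in> ?U" using above that by blast
    then show ?thesis using True f that by (auto simp: g_def condensation_def)
  next
    case x: False
    show ?thesis
    proof (cases "y \<in> ?U")
      case True
      then have "g y \<in> ?U" using gU by blast
      then show ?thesis using below[of x y "g y"] x True that by (auto simp: g_def)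
    qed (use x that in \<open>simp add: g_def\<close>)
  qed
  ultimately have "condensation T r g" by (auto simp: condensation_def)
  then have "automorphism T r g" using rev by (auto simp: reversible_def)
  then have "(x, y) \<in> r \<longleftrightarrow> (f x, f y) \<in> r" if "x \<in> ?U" "y \<in> ?U" for x y
    using that subsetD[OF UT that(1)] subsetD[OF UT that(2)] by (simp add: automorphism_def g_def)
  then show "automorphism ?U r f" using fU by (auto simp: automorphism_def)
qed

theorem theorem3p2:
  fixes T :: "'a set" and r :: "'a rel"
  shows "(bad_tree T r \<longrightarrow> \<not> reversible T r) \<and>
    (tree T r \<and> (\<exists>N\<in>nodes T r. \<exists>S\<subseteq>N. bad_tree (up T r S) r) \<longrightarrow> \<not> reversible T r)"
  using bad_tree_not_reversible reversible_up by blast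

end
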